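(* Let $n\ge 5$ and let $G$ be a unicyclic graph on $n$ vertices. If $G\not\cong C_n$ and $G\not\cong C_n^*$, then $ER(G)>\min\{ER(C_n),ER(C_n^* )\}$.
   Context: All graphs are finite, simple and undirected. For a graph $G$ on $n$ vertices with adjacency eigenvalues $\lambda_1\ge\cdots\ge\lambda_n$, the resolvent energy is $ER(G)=\sum_{i=1}^n \frac{1}{n-\lambda_i}$. A unicyclic graph is a connected graph with $n$ vertices and $n$ edges. $C_n$ is the cycle on $n$ vertices, and $C_n^*$ denotes the unicyclic graph on $n$ vertices obtained by attaching one pendent vertex to a vertex of the cycle $C_{n-1}$. *)

theory Defs
  imports
    "Graph_Theory.Graph_Theory"
    "Jordan_Normal_Form.Char_Poly"
begin

text \<open>
  A finite simple undirected graph is a \<open>pair_graph\<close>: a finite, loop-free, symmetric digraph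
  without parallel arcs. Each undirected edge \<open>{u, v}\<close> is represented by the two arcs
  \<open>(u, v)\<close> and \<open>(v, u)\<close>.
\<close>

definition edges :: "'a pair_pre_digraph \<Rightarrow> 'a set set" where
  "edges G = (\<lambda>(u, v). {u, v}) ` parcs G"

definition unicyclic :: "'a pair_pre_digraph \<Rightarrow> bool" where
  "unicyclic G \<longleftrightarrow>
     pair_graph G \<and> connected (with_proj G) \<and> card (edges G) = card (pverts G)"

definition graph_iso :: "'a pair_pre_digraph \<Rightarrow> 'b pair_pre_digraph \<Rightarrow> bool" where
  "graph_iso G H \<longleftrightarrow> digraph_iso (with_proj G) (with_proj H)"

definition adj_mat :: "'a pair_pre_digraph \<Rightarrow> 'a list \<Rightarrow> real mat" where
  "adj_mat G vs =
     mat (length vs) (length vs) (\<lambda>(i, j). if (vs ! i, vs ! j) \<in> parcs G then 1 else 0)"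

text \<open>
  The eigenvalues with multiplicity, i.e. the roots of the characteristic polynomial. The
  enumeration of the vertices is immaterial, see \<open>adj_eigenvalues_eq\<close> below. Taking real roots
  loses nothing, as the matrix is real symmetric.
\<close>

definition adj_eigenvalues :: "'a pair_pre_digraph \<Rightarrow> real multiset" where
  "adj_eigenvalues G =
     proots (char_poly (adj_mat G (SOME vs. distinct vs \<and> set vs = pverts G)))"

definition resolvent_energy :: "'a pair_pre_digraph \<Rightarrow> real" where
  "resolvent_energy G = (\<Sum>x\<in>#adj_eigenvalues G. 1 / (real (card (pverts G)) - x))"

text \<open>\<open>cycle_graph n\<close> is the cycle $C_n$ for \<open>n \<ge> 3\<close>.\<close>

definition cycle_graph :: "nat \<Rightarrow> nat pair_pre_digraph" where
  "cycle_graph n =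
     \<lparr>pverts = {..<n},
      parcs = {(i, j). i < n \<and> j < n \<and> (j = (i + 1) mod n \<or> i = (j + 1) mod n)}\<rparr>"

text \<open>
  \<open>cycle_pendant_graph n\<close> is $C_n^*$ for \<open>n \<ge> 4\<close>: the pendent vertex \<open>n - 1\<close> is attached to
  vertex \<open>0\<close> of the cycle on \<open>{..<n - 1}\<close>.
\<close>

definition cycle_pendant_graph :: "nat \<Rightarrow> nat pair_pre_digraph" where
  "cycle_pendant_graph n =
     \<lparr>pverts = insert (n - 1) (pverts (cycle_graph (n - 1))),
      parcs = parcs (cycle_graph (n - 1)) \<union> {(0, n - 1), (n - 1, 0)}\<rparr>"

lemma char_poly_adj_mat_eq:
  assumes "distinct vs" "distinct ws" "set vs = set ws"
  shows "char_poly (adj_mat G vs) = char_poly (adj_mat G ws)"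
proof -
  let ?n = "length vs"
  have len: "length ws = ?n"
    using assms by (metis distinct_card)
  define P :: "real mat" where "P = mat ?n ?n (\<lambda>(i, j). if vs ! i = ws ! j then 1 else 0)"
  define Q :: "real mat" where "Q = mat ?n ?n (\<lambda>(i, j). if ws ! i = vs ! j then 1 else 0)"
  define f where "f i = (THE j. j < ?n \<and> ws ! j = vs ! i)" for i
  have f: "f i < ?n \<and> ws ! (f i) = vs ! i" if "i < ?n" for i
    unfolding f_def
  proof (rule theI')
    have "vs ! i \<in> set ws" using assms(3) that by (metis nth_mem)
    then show "\<exists>!j. j < ?n \<and> ws ! j = vs ! i"
      using assms(2) len by (metis distinct_Ex1)
  qed
  have iff1: "vs ! i = ws ! j \<longleftrightarrow> j = f i" if "i < ?n" "j < ?n" for i j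
    using f[OF that(1)] that assms(2) len by (metis nth_eq_iff_index_eq)
  have iff2: "f i = f j \<longleftrightarrow> i = j" if "i < ?n" "j < ?n" for i j
    using f[OF that(1)] f[OF that(2)] that assms(1) by (metis nth_eq_iff_index_eq)
  have A: "adj_mat G vs \<in> carrier_mat ?n ?n" and B: "adj_mat G ws \<in> carrier_mat ?n ?n"
    by (auto simp: adj_mat_def len)
  have P: "P \<in> carrier_mat ?n ?n" and Q: "Q \<in> carrier_mat ?n ?n"
    by (auto simp: P_def Q_def)
  have PQ: "P * Q = 1\<^sub>m ?n"
  proof (rule eq_matI)
    fix i j assume "i < dim_row (1\<^sub>m ?n)" "j < dim_col (1\<^sub>m ?n)"
    then have ij: "i < ?n" "j < ?n" by auto
    have "(P * Q) $$ (i, j) = (\<Sum>k = 0..<?n. P $$ (i, k) * Q $$ (k, j))"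
      using ij P Q by (simp add: scalar_prod_def)
    also have "\<dots> = (\<Sum>k = 0..<?n. if k = f i then (if k = f j then 1 else 0) else 0)"
      using ij by (intro sum.cong) (auto simp: P_def Q_def iff1 eq_commute[of "ws ! _"])
    also have "\<dots> = 1\<^sub>m ?n $$ (i, j)"
      using ij f by (auto simp: sum.delta iff2)
    finally show "(P * Q) $$ (i, j) = 1\<^sub>m ?n $$ (i, j)" .
  qed (use P Q in auto)
  have QP: "Q * P = 1\<^sub>m ?n"
    using mat_mult_left_right_inverse[OF P Q PQ] .
  have AP: "adj_mat G vs * P = P * adj_mat G ws"
  proof (rule eq_matI)
    fix i j assume "i < dim_row (P * adj_mat G ws)" "j < dim_col (P * adj_mat G ws)"
    then have ij: "i < ?n" "j < ?n" using P B by auto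
    have "ws ! j \<in> set vs" using assms(3) ij len by (metis nth_mem)
    then obtain l where l: "l < ?n" "vs ! l = ws ! j" by (metis in_set_conv_nth)
    then have lj: "j = f l" using iff1[OF l(1) ij(2)] by simp
    have "(adj_mat G vs * P) $$ (i, j) = (\<Sum>k = 0..<?n. adj_mat G vs $$ (i, k) * P $$ (k, j))"
      using ij A P by (simp add: scalar_prod_def)
    also have "\<dots> = (\<Sum>k = 0..<?n. if k = l then adj_mat G vs $$ (i, k) else 0)"
      using ij l by (intro sum.cong) (auto simp: P_def iff1 lj iff2)
    also have "\<dots> = (if (vs ! i, ws ! j) \<in> parcs G then 1 else 0)"
      using ij l by (simp add: sum.delta adj_mat_def)
    also have "\<dots> = (\<Sum>k = 0..<?n. if k = f i then adj_mat G ws $$ (k, j) else 0)"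
      using ij f[OF ij(1)] by (simp add: sum.delta adj_mat_def len)
    also have "\<dots> = (\<Sum>k = 0..<?n. P $$ (i, k) * adj_mat G ws $$ (k, j))"
      using ij by (intro sum.cong) (auto simp: P_def iff1)
    also have "\<dots> = (P * adj_mat G ws) $$ (i, j)"
      using ij B P by (simp add: scalar_prod_def)
    finally show "(adj_mat G vs * P) $$ (i, j) = (P * adj_mat G ws) $$ (i, j)" .
  qed (use A B P in auto)
  have "adj_mat G vs = adj_mat G vs * (P * Q)"
    using A PQ by simp
  also have "\<dots> = P * adj_mat G ws * Q"
    using A P Q AP by (simp flip: assoc_mult_mat)
  finally have "similar_mat (adj_mat G vs) (adj_mat G ws)"
    using A B P Q PQ QP by (intro similar_matI[of _ _ P Q ?n]) auto
  then show ?thesis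
    by (rule char_poly_similar)
qed

lemma adj_eigenvalues_eq:
  assumes "distinct vs" "set vs = pverts G"
  shows "adj_eigenvalues G = proots (char_poly (adj_mat G vs))"
proof -
  let ?ws = "SOME ws. distinct ws \<and> set ws = pverts G"
  have "distinct ?ws \<and> set ?ws = pverts G"
    by (rule someI[of _ vs]) (use assms in auto)
  then show ?thesis
    using char_poly_adj_mat_eq[of ?ws vs G] assms by (simp add: adj_eigenvalues_def)
qed

end

theory Submission
  imports Defs "Jordan_Normal_Form.Schur_Decomposition"
begin

text \<open>
  The minimum is bounded by $ER(C_n)$, and already $ER(G) > ER(C_n)$. Write $M_k$ for the sum of the $k$-th powers of the eigenvalues,
  which is the trace of the $k$-th power of the adjacency matrix.

  Lower bound: truncate the geometric series of $1/(n - x)$ after $x^7$, drop the nonnegative odd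
  moments and estimate $x^6 \ge 6x^4 - 9x^2$. It remains to know $M_0 = n$, $M_2 = 2n$ and
  $M_4 \ge 2 \sum_v d_v^2 - 2n \ge 6n + 4$. The last inequality holds unless all degrees $d_v$ equal
  2, in which case the connected graph $G$ is a cycle.

  Upper bound: $W(x) = (x - 2)(x^2 + x - 1)^2 = x^5 - 5x^3 + 5x - 2$, the characteristic polynomial
  of $C_5$, is nonpositive on $(-\infty, 2]$, which contains the spectrum of $C_n$. Hence
  $1/(n - x) \le (1 - W(x)/W(n))/(n - x)$ there, and the right-hand side is a polynomial of degree
  4 in $x$, so that $M_0, \dots, M_4$ of $C_n$ suffice.
\<close>

subsection \<open>Spectral moments of real symmetric matrices\<close>

definition mat_trace :: "'a :: comm_monoid_add mat \<Rightarrow> 'a" where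
  "mat_trace A = (\<Sum>i<dim_row A. A $$ (i, i))"

lemma mat_trace_mult:
  fixes A B :: "'a :: semiring_0 mat"
  assumes "A \<in> carrier_mat n n" "B \<in> carrier_mat n n"
  shows "mat_trace (A * B) = (\<Sum>i<n. \<Sum>j<n. A $$ (i, j) * B $$ (j, i))"
  using assms by (auto simp: mat_trace_def scalar_prod_def lessThan_atLeast0 intro!: sum.cong)

lemma mat_trace_mult_commute:
  fixes A B :: "'a :: comm_semiring_0 mat"
  assumes "A \<in> carrier_mat n n" "B \<in> carrier_mat n n"
  shows "mat_trace (A * B) = mat_trace (B * A)"
  unfolding mat_trace_mult[OF assms] mat_trace_mult[OF assms(2,1)]
  by (subst sum.swap) (simp add: mult.commute)

lemma mat_trace_similar:
  fixes A B :: "'a :: comm_semiring_1 mat"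
  assumes "similar_mat_wit A B P Q"
  shows "mat_trace A = mat_trace B"
proof -
  note w = similar_mat_witD[OF refl assms]
  let ?n = "dim_row A"
  have "mat_trace A = mat_trace (P * (B * Q))"
    using w(3) assoc_mult_mat[OF w(6,5,7)] by simp
  also have "\<dots> = mat_trace (B * Q * P)"
    using w(5-7) by (intro mat_trace_mult_commute[of _ ?n]) auto
  also have "B * Q * P = B * (Q * P)"
    using w(5-7) by (intro assoc_mult_mat)
  also have "\<dots> = B"
    using w(2,5) by simp
  finally show ?thesis .
qed

text \<open>The product of entry (i, l) of \<open>B ^\<^sub>m k\<close> and entry (l, j) of
  \<open>B\<close> survives only for i \<le> l \<le> j: no such l exists below the diagonal, and on
  it only l = i.\<close>

lemma upper_triangular_pow:
  fixes B :: "'a :: comm_semiring_1 mat"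
  assumes "B \<in> carrier_mat n n" "upper_triangular B"
  shows "upper_triangular (B ^\<^sub>m k) \<and> (\<forall>i<n. (B ^\<^sub>m k) $$ (i, i) = B $$ (i, i) ^ k)"
proof (induction k)
  case 0
  then show ?case using assms by (auto simp: upper_triangular_def)
next
  case (Suc k)
  have C: "B ^\<^sub>m k \<in> carrier_mat n n" using assms by simp
  have e: "(B ^\<^sub>m Suc k) $$ (i, j) = (\<Sum>l<n. (B ^\<^sub>m k) $$ (i, l) * B $$ (l, j))"
    if "i < n" "j < n" for i j
    using that C assms by (auto simp: scalar_prod_def lessThan_atLeast0 intro!: sum.cong)
  have z: "(B ^\<^sub>m k) $$ (i, l) * B $$ (l, j) = 0" if "i < n" "l < n" "l < i \<or> j < l" for i j l
    using that Suc.IH C assms by (auto simp: upper_triangular_def)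
  have "(B ^\<^sub>m Suc k) $$ (i, j) = 0" if "i < n" "j < i" for i j
    using that by (subst e) (auto intro!: sum.neutral z)
  moreover have "(B ^\<^sub>m Suc k) $$ (i, i) = B $$ (i, i) ^ Suc k" if "i < n" for i
  proof -
    have "(B ^\<^sub>m Suc k) $$ (i, i) = (\<Sum>l\<in>{i}. (B ^\<^sub>m k) $$ (i, l) * B $$ (l, i))"
      unfolding e[OF that that]
      using that by (intro sum.mono_neutral_right) (auto intro!: z)
    then show ?thesis using that Suc.IH by (simp add: mult.commute)
  qed
  ultimately show ?case
    using assms C by (auto simp: upper_triangular_def)
qed

text \<open>Over the complex numbers the polynomial splits. A root a with eigenvector v satisfies v*
  A v = a v* v; symmetry makes the left-hand side real and v* v is positive, so a is real. The
  factorization descends to the reals because embedding the coefficients is injective.\<close>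

lemma char_poly_real_symmetric_splits:
  fixes A :: "real mat"
  assumes A: "A \<in> carrier_mat n n" and tr: "transpose_mat A = A"
  obtains es where "char_poly A = (\<Prod>e\<leftarrow>es. [:- e, 1:])" "length es = n"
proof -
  have sym: "A $$ (i, j) = A $$ (j, i)" if "i < n" "j < n" for i j
    using A that by (subst tr[symmetric]) simp
  let ?C = "map_mat complex_of_real A"
  have C: "?C \<in> carrier_mat n n" using A by simp
  obtain as where as: "char_poly ?C = (\<Prod>a\<leftarrow>as. [:- a, 1:])" "length as = n"
    using char_poly_factorized[OF C] by blast
  have real: "complex_of_real (Re a) = a" if "a \<in> set as" for a
  proof -
    have "poly (char_poly ?C) a = 0"
      unfolding as by (rule linear_poly_root[OF that])
    then have "eigenvalue ?C a"
      using eigenvalue_root_char_poly[OF C] by simp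
    then obtain v where v: "v \<in> carrier_vec n" "v \<noteq> 0\<^sub>v n" "?C *\<^sub>v v = a \<cdot>\<^sub>v v"
      using C by (auto simp: eigenvalue_def eigenvector_def)
    have ev: "(\<Sum>j<n. of_real (A $$ (i, j)) * v $ j) = a * v $ i" if "i < n" for i
    proof -
      have "(?C *\<^sub>v v) $ i = (a \<cdot>\<^sub>v v) $ i" using v by simp
      then show ?thesis
        using that v(1) A by (simp add: scalar_prod_def lessThan_atLeast0 cong: sum.cong_simp)
    qed
    \<comment> \<open>The squared norm v* v and the Hermitian form v* A v.\<close>
    define S where "S = (\<Sum>i<n. cnj (v $ i) * v $ i)"
    define T where "T = (\<Sum>i<n. \<Sum>j<n. cnj (v $ i) * of_real (A $$ (i, j)) * v $ j)"
    have T: "T = a * S"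
      unfolding T_def S_def sum_distrib_left
      by (intro sum.cong refl) (simp add: ev mult.assoc mult.left_commute flip: sum_distrib_left)
    have "cnj T = (\<Sum>i<n. \<Sum>j<n. v $ i * of_real (A $$ (i, j)) * cnj (v $ j))"
      by (simp add: T_def)
    also have "\<dots> = T"
      unfolding T_def by (subst sum.swap, intro sum.cong refl) (auto simp: sym mult_ac)
    finally have "cnj T = T" .
    moreover have "cnj S = S" by (simp add: S_def mult.commute)
    moreover have "S \<noteq> 0"
    proof -
      obtain i where i: "i < n" "v $ i \<noteq> 0"
        using v by (metis carrier_vecD eq_vecI index_zero_vec(1,2))
      have "Re S = (\<Sum>i<n. (cmod (v $ i))\<^sup>2)"
        by (simp only: S_def cmod_power2) (simp add: power2_eq_square)
      also have "\<dots> > 0"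
        using i by (intro sum_pos2[of _ i]) auto
      finally show ?thesis by auto
    qed
    ultimately have "cnj a = a" using T by auto
    then show ?thesis by (simp add: complex_eq_iff)
  qed
  interpret of_real_hom: inj_comm_ring_hom complex_of_real
    by unfold_locales auto
  interpret P: map_poly_inj_comm_ring_hom complex_of_real ..
  have "map_poly complex_of_real (char_poly A) = char_poly ?C"
    by (simp add: of_real_hom.char_poly_hom[OF A])
  also have "\<dots> = (\<Prod>a\<leftarrow>as. map_poly complex_of_real [:- Re a, 1:])"
    unfolding as using real by (intro arg_cong[where f = prod_list] map_cong) auto
  also have "\<dots> = map_poly complex_of_real (\<Prod>e\<leftarrow>map Re as. [:- e, 1:])"
    by (simp add: P.hom_prod_list o_def)
  finally have "char_poly A = (\<Prod>e\<leftarrow>map Re as. [:- e, 1:])"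
    by (rule P.injectivity)
  then show ?thesis using that[of "map Re as"] as(2) by simp
qed

text \<open>Since the characteristic polynomial splits over the reals, Schur decomposition makes
  \<open>A\<close> similar to a triangular \<open>B\<close> with the eigenvalues on its diagonal;
  the trace of each power is invariant under this similarity.\<close>

lemma power_sum_eigenvalues_real_symmetric:
  fixes A :: "real mat"
  assumes A: "A \<in> carrier_mat n n" and tr: "transpose_mat A = A"
  shows "(\<Sum>x\<in>#proots (char_poly A). x ^ k) = mat_trace (A ^\<^sub>m k)"
proof -
  obtain es where es: "char_poly A = (\<Prod>e\<leftarrow>es. [:- e, 1:])" "length es = n"
    using char_poly_real_symmetric_splits[OF assms] .
  obtain B P Q where "schur_decomposition A es = (B, P, Q)"
    by (metis prod_cases3)
  from schur_decomposition[OF A es(1) this]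
  have w: "similar_mat_wit A B P Q" "upper_triangular B" "diag_mat B = es" by auto
  have B: "B \<in> carrier_mat n n" using similar_mat_witD2[OF A w(1)] by simp
  have "proots (char_poly A) = mset es"
    unfolding es(1)
    by (induction es) (simp_all add: proots_mult prod_list_zero_iff image_iff del: mult_pCons_left)
  then have "(\<Sum>x\<in>#proots (char_poly A). x ^ k) = (\<Sum>x\<leftarrow>es. x ^ k)"
    by (simp flip: sum_mset_sum_list)
  also have "\<dots> = (\<Sum>i<n. B $$ (i, i) ^ k)"
    using B by (simp add: w(3)[symmetric] diag_mat_def interv_sum_list_conv_sum_set_nat o_def
        lessThan_atLeast0)
  also have "\<dots> = mat_trace (B ^\<^sub>m k)"
    using upper_triangular_pow[OF B w(2)] B by (simp add: mat_trace_def)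
  also have "\<dots> = mat_trace (A ^\<^sub>m k)"
    using mat_trace_similar[OF similar_mat_wit_pow[OF w(1)]] by simp
  finally show ?thesis .
qed

text \<open>Gershgorin's argument: compare both sides of A v = x v at an index where v is largest in
  absolute value. It confines the spectrum of $C_n$ to [-2, 2] and that of $G$ to (-n, n).\<close>

lemma abs_eigenvalue_le_row_sum:
  fixes A :: "real mat"
  assumes A: "A \<in> carrier_mat n n" and x: "x \<in># proots (char_poly A)"
    and row: "\<And>i. i < n \<Longrightarrow> (\<Sum>j<n. \<bar>A $$ (i, j)\<bar>) \<le> D"
  shows "\<bar>x\<bar> \<le> D"
proof -
  have "char_poly A \<noteq> 0" using degree_monic_char_poly[OF A] by auto
  then have "eigenvalue A x"
    using x eigenvalue_root_char_poly[OF A] by simp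
  then obtain v where v: "v \<in> carrier_vec n" "v \<noteq> 0\<^sub>v n" "A *\<^sub>v v = x \<cdot>\<^sub>v v"
    using A by (auto simp: eigenvalue_def eigenvector_def)
  obtain l where l: "l < n" "v $ l \<noteq> 0"
    using v by (metis carrier_vecD eq_vecI index_zero_vec(1,2))
  define m where "m = Max ((\<lambda>i. \<bar>v $ i\<bar>) ` {..<n})"
  have "m \<in> (\<lambda>i. \<bar>v $ i\<bar>) ` {..<n}"
    unfolding m_def using l by (intro Max_in) auto
  then obtain i where i: "i < n" "m = \<bar>v $ i\<bar>" by auto
  have le: "\<bar>v $ j\<bar> \<le> m" if "j < n" for j
    unfolding m_def using that by (intro Max_ge) auto
  have "m > 0" using le[OF l(1)] l by auto
  have "(A *\<^sub>v v) $ i = (x \<cdot>\<^sub>v v) $ i" using v by simp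
  then have "x * v $ i = (\<Sum>j<n. A $$ (i, j) * v $ j)"
    using i v(1) A by (simp add: scalar_prod_def lessThan_atLeast0 cong: sum.cong_simp)
  then have "\<bar>x\<bar> * m = \<bar>\<Sum>j<n. A $$ (i, j) * v $ j\<bar>"
    using i by (simp flip: abs_mult)
  also have "\<dots> \<le> (\<Sum>j<n. \<bar>A $$ (i, j)\<bar> * m)"
    by (rule order_trans[OF sum_abs]) (auto simp: abs_mult intro!: sum_mono mult_left_mono le)
  also have "\<dots> \<le> D * m"
    using row[OF i(1)] \<open>m > 0\<close> by (simp flip: sum_distrib_right)
  finally show ?thesis using \<open>m > 0\<close> by simp
qed

text \<open>Serves to discard the odd moments in the lower bound.\<close>

lemma mat_trace_pow_nonneg:
  fixes A :: "'a :: linordered_semidom mat"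
  assumes A: "A \<in> carrier_mat n n" and nn: "\<And>i j. i < n \<Longrightarrow> j < n \<Longrightarrow> A $$ (i, j) \<ge> 0"
  shows "mat_trace (A ^\<^sub>m k) \<ge> 0"
proof -
  have "(A ^\<^sub>m k) $$ (i, j) \<ge> 0" if "i < n" "j < n" for i j
    using that
  proof (induction k arbitrary: i j)
    case (Suc k)
    have "(A ^\<^sub>m Suc k) $$ (i, j) = (\<Sum>l<n. (A ^\<^sub>m k) $$ (i, l) * A $$ (l, j))"
      using Suc.prems A by (auto simp: scalar_prod_def lessThan_atLeast0 intro!: sum.cong)
    also have "\<dots> \<ge> 0"
      using Suc nn by (intro sum_nonneg mult_nonneg_nonneg) auto
    finally show ?case .
  qed (use A in auto)
  then show ?thesis
    using A by (auto simp: mat_trace_def intro!: sum_nonneg)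
qed

text \<open>\<open>B\<close> holds the entries of \<open>A * A\<close>. Reading the third and fourth
  powers as (A A) A and (A A)(A A), symmetry turns their traces into entrywise sums, the latter a
  sum of squares.\<close>

lemma mat_trace_pow_low:
  fixes A :: "real mat"
  assumes A: "A \<in> carrier_mat n n" and tr: "transpose_mat A = A"
  defines "B \<equiv> \<lambda>i j. \<Sum>l<n. A $$ (i, l) * A $$ (l, j)"
  shows "mat_trace (A ^\<^sub>m 0) = n"
    and "mat_trace (A ^\<^sub>m 1) = (\<Sum>i<n. A $$ (i, i))"
    and "mat_trace (A ^\<^sub>m 2) = (\<Sum>i<n. B i i)"
    and "mat_trace (A ^\<^sub>m 3) = (\<Sum>i<n. \<Sum>j<n. B i j * A $$ (i, j))"
    and "mat_trace (A ^\<^sub>m 4) = (\<Sum>i<n. \<Sum>j<n. (B i j)\<^sup>2)"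
proof -
  have sym: "A $$ (i, j) = A $$ (j, i)" if "i < n" "j < n" for i j
    using A that by (subst tr[symmetric]) simp
  have AA: "A * A \<in> carrier_mat n n" using A by simp
  have BE: "(A * A) $$ (i, j) = B i j" if "i < n" "j < n" for i j
    using that A by (auto simp: B_def scalar_prod_def lessThan_atLeast0 intro!: sum.cong)
  have B_sym: "B i j = B j i" if "i < n" "j < n" for i j
    unfolding B_def using that by (intro sum.cong) (auto simp: sym mult.commute)
  have pow: "A ^\<^sub>m 1 = A" "A ^\<^sub>m 2 = A * A" "A ^\<^sub>m 3 = (A * A) * A" "A ^\<^sub>m 4 = (A * A) * (A * A)"
    using A by (simp_all add: numeral_eq_Suc assoc_mult_mat[of _ n n _ n _ n])
  show "mat_trace (A ^\<^sub>m 0) = n"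
    using A by (simp add: mat_trace_def)
  show "mat_trace (A ^\<^sub>m 1) = (\<Sum>i<n. A $$ (i, i))"
    using A unfolding pow by (simp add: mat_trace_def)
  show "mat_trace (A ^\<^sub>m 2) = (\<Sum>i<n. B i i)"
    using A by (simp add: pow mat_trace_mult B_def)
  show "mat_trace (A ^\<^sub>m 3) = (\<Sum>i<n. \<Sum>j<n. B i j * A $$ (i, j))"
    unfolding pow mat_trace_mult[OF AA A] by (intro sum.cong) (auto simp: BE sym)
  show "mat_trace (A ^\<^sub>m 4) = (\<Sum>i<n. \<Sum>j<n. (B i j)\<^sup>2)"
    unfolding pow mat_trace_mult[OF AA AA]
    by (intro sum.cong) (auto simp: BE power2_eq_square B_sym)
qed

subsection \<open>Connected 2-regular graphs are cycles\<close>

lemma graph_isoI: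
  assumes "pair_wf_digraph G" "pair_wf_digraph H" and bij: "bij_betw f (pverts G) (pverts H)"
    and arc: "\<And>u v. u \<in> pverts G \<Longrightarrow> v \<in> pverts G \<Longrightarrow>
      (u, v) \<in> parcs G \<longleftrightarrow> (f u, f v) \<in> parcs H"
  shows "graph_iso G H"
proof -
  interpret G: pair_wf_digraph G by fact
  interpret H: pair_wf_digraph H by fact
  \<comment> \<open>Arcs are pairs of vertices, so \<open>f\<close> determines the map on
    arcs.\<close>
  let ?h = "\<lparr>iso_verts = f, iso_arcs = map_prod f f, iso_head = snd, iso_tail = fst\<rparr>"
  have inj: "inj_on f (pverts G)" and im: "f ` pverts G = pverts H"
    using bij by (auto simp: bij_betw_def)
  have "inj_on (map_prod f f) (parcs G)"
    using inj G.wellformed' by (intro inj_onI) (clarsimp, metis inj_onD)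
  then have "pre_digraph.digraph_isomorphism (with_proj G) ?h"
    using inj G.wf_digraph by (auto simp: pre_digraph.digraph_isomorphism_def)
  moreover have "parcs H = map_prod f f ` parcs G"
  proof (intro equalityI subrelI)
    fix a b assume ab: "(a, b) \<in> parcs H"
    then have "a \<in> f ` pverts G" "b \<in> f ` pverts G"
      using H.wellformed' im by auto
    then obtain u v where "u \<in> pverts G" "v \<in> pverts G" "a = f u" "b = f v" by auto
    then show "(a, b) \<in> map_prod f f ` parcs G" using arc ab by force
  next
    fix a b assume "(a, b) \<in> map_prod f f ` parcs G"
    then show "(a, b) \<in> parcs H" using arc by (auto dest: G.wellformed')
  qed
  then have "with_proj H = app_iso ?h (with_proj G)"
    using im by (auto simp: app_iso_def with_proj_def)
  ultimately show ?thesis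
    unfolding graph_iso_def digraph_iso_def by blast
qed

lemma pair_graph_cycle_graph:
  assumes "n \<ge> 3"
  shows "pair_graph (cycle_graph n)"
proof -
  have "finite {(i, j). i < n \<and> j < n \<and> (j = (i + 1) mod n \<or> i = (j + 1) mod n)}"
    by (rule finite_subset[of _ "{..<n} \<times> {..<n}"]) auto
  moreover have "i \<noteq> Suc i mod n" "Suc i mod n \<noteq> i" if "i < n" for i
    using that assms by (auto simp: mod_Suc split: if_splits)
  ultimately show ?thesis
    by unfold_locales
      (use assms in \<open>auto simp: cycle_graph_def symmetric_def intro!: symI\<close>)
qed

context pair_graph
begin

text \<open>A connected symmetric digraph is strongly connected, so every vertex is reachable from
  \<open>S\<close>. This later shows that the closed walk visits all of \<open>G\<close>.\<close>

lemma closed_under_arcs_eq_pverts: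
  assumes conn: "connected (with_proj G)" and S: "S \<subseteq> pverts G" "S \<noteq> {}"
    and cl: "\<And>u v. u \<in> S \<Longrightarrow> (u, v) \<in> parcs G \<Longrightarrow> v \<in> S"
  shows "S = pverts G"
proof
  have sc: "strongly_connected (with_proj G)"
    using symmetric_connected_imp_strongly_connected[OF pair_sym_arcs conn] .
  obtain u where u: "u \<in> S" using S by auto
  show "pverts G \<subseteq> S"
  proof
    fix v assume "v \<in> pverts G"
    then have "u \<rightarrow>\<^sup>*\<^bsub>with_proj G\<^esub> v"
      using sc u S by (auto simp: strongly_connected_def)
    then show "v \<in> S"
      by (induction rule: reachable_induct) (use u cl in auto)
  qed
qed fact

text \<open>
  The walk that never turns back must close up at its starting vertex: a first repetition anywhere
  else would give that vertex a third neighbour.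
\<close>

lemma connected_2_regular_iso_cycle:
  assumes conn: "connected (with_proj G)"
    and deg: "\<And>u. u \<in> pverts G \<Longrightarrow> card {v. (u, v) \<in> parcs G} = 2"
  shows "graph_iso G (cycle_graph (card (pverts G)))"
proof -
  define N where "N u = {v. (u, v) \<in> parcs G}" for u
  have "pverts G \<noteq> {}"
    using conn unfolding connected_conv by simp
  then obtain u0 where u0: "u0 \<in> pverts G" by auto
  have "N u0 \<noteq> {}" using deg[OF u0] unfolding N_def by force
  then obtain v0 where v0: "(u0, v0) \<in> parcs G" by (auto simp: N_def)
  \<comment> \<open>The continuation of a walk that arrives at v from u without turning back; it
    exists because v has two neighbours.\<close>
  define other where "other u v = (SOME w. (v, w) \<in> parcs G \<and> w \<noteq> u)" for u v
  have other: "(v, other u v) \<in> parcs G \<and> other u v \<noteq> u" if "(u, v) \<in> parcs G" for u v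
    unfolding other_def
  proof (rule someI_ex)
    have "card (N v) = 2" using deg that by (auto simp: N_def dest: wellformed')
    then obtain a b where "N v = {a, b}" "a \<noteq> b" by (auto simp: card_2_iff)
    then show "\<exists>w. (v, w) \<in> parcs G \<and> w \<noteq> u" by (auto simp: N_def set_eq_iff)
  qed
  \<comment> \<open>The state is an arc, since the next vertex depends on the last two.\<close>
  define st where "st k = ((\<lambda>(u, v). (v, other u v)) ^^ k) (u0, v0)" for k
  define x where "x k = fst (st k)" for k
  have st: "st k = (x k, x (Suc k))" for k
    by (simp add: st_def x_def case_prod_unfold)
  have xSS: "x (Suc (Suc k)) = other (x k) (x (Suc k))" for k
    using st[of k] by (simp add: st_def x_def case_prod_unfold)
  have arc: "(x k, x (Suc k)) \<in> parcs G" for k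
  proof (induction k)
    case 0
    show ?case using v0 st[of 0] by (simp add: st_def)
  next
    case (Suc k)
    then show ?case using other by (simp add: xSS)
  qed
  have ne: "x (Suc (Suc k)) \<noteq> x k" for k
    using other[OF arc[of k]] by (simp add: xSS)
  \<comment> \<open>The walk's predecessor and successor are distinct, so by degree 2 they are all
    the neighbours.\<close>
  have N_Suc: "N (x (Suc k)) = {x k, x (Suc (Suc k))}" for k
  proof -
    have "card (N (x (Suc k))) = 2"
      using deg arc by (auto simp: N_def dest: wellformed')
    moreover have "{x k, x (Suc (Suc k))} \<subseteq> N (x (Suc k))"
      using arc[of k] arc[of "Suc k"] by (auto simp: N_def intro: arcs_symmetric)
    ultimately show ?thesis
      using ne[of k] by (metis card.infinite card_2_iff card_subset_eq zero_neq_numeral)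
  qed
  have x_verts: "x k \<in> pverts G" for k
    using arc[of k] by (auto dest: wellformed')
  have "\<not> inj x"
    using pair_finite_verts x_verts by (meson finite_imageD finite_subset image_subsetI infinite_UNIV_nat)
  then have ex: "\<exists>p. \<exists>i<p. x p = x i"
    by (metis injI nat_neq_iff)
  \<comment> \<open>The first index that repeats an earlier vertex, so the walk is injective below
    \<open>p\<close>.\<close>
  define p where "p = (LEAST p. \<exists>i<p. x p = x i)"
  obtain i where i: "i < p" "x p = x i"
    using LeastI_ex[OF ex] unfolding p_def by blast
  have "\<not> (\<exists>i<q. x q = x i)" if "q < p" for q
    using not_less_Least that unfolding p_def by blast
  then have inj: "inj_on x {..<p}"
    by (intro inj_onI) (metis lessThan_iff nat_neq_iff)
  obtain q where q: "p = Suc q" using i by (cases p) auto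
  \<comment> \<open>Otherwise \<open>x i\<close> has only the neighbours \<open>x j\<close> and
    \<open>x (Suc i)\<close>, and the predecessor \<open>x q\<close> of \<open>x p = x i\<close>
    must be one of them. The first contradicts injectivity; the second gives a loop if
    \<open>Suc i = p\<close>, and a reversal \<open>x (Suc (Suc i)) = x i\<close> otherwise.\<close>
  have "i = 0"
  proof (rule ccontr)
    assume "i \<noteq> 0"
    then obtain j where j: "i = Suc j" by (cases i) auto
    have "x q \<in> N (x p)"
      using arc[of q] by (auto simp: N_def q intro: arcs_symmetric)
    then have "x q = x j \<or> x q = x (Suc i)"
      using i j N_Suc[of j] by auto
    moreover have "x q \<noteq> x j"
      using inj_onD[OF inj, of q j] i j q by auto
    ultimately have eq: "x q = x (Suc i)" by simp
    show False
    proof (cases "Suc i = p")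
      case True
      then show False using eq arc[of q] q by (auto dest: no_loops')
    next
      case False
      then have "q = Suc i"
        using eq inj_onD[OF inj, of q "Suc i"] i q by auto
      then show False using ne[of i] i q by simp
    qed
  qed
  then have xp: "x p = x 0" using i by simp
  \<comment> \<open>A return after one step would be a loop, after two steps a reversal; hence the
    cycle has at least 3 vertices.\<close>
  have "q \<noteq> 0" using xp no_loops'[OF arc[of 0]] q by (cases q) auto
  moreover have "q \<noteq> 1" using xp ne[of 0] q by auto
  ultimately have q2: "q \<ge> 2" by simp
  \<comment> \<open>The neighbours of \<open>x p = x 0\<close> are \<open>x q\<close> and
    \<open>x (Suc p)\<close>. As \<open>x 1\<close> is a neighbour other than \<open>x q\<close>, it
    is the second one.\<close>
  have N0: "N (x 0) = {x 1, x q}"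
  proof -
    have "N (x 0) = {x q, x (Suc p)}" using N_Suc[of q] xp q by simp
    moreover have "x 1 \<in> N (x 0)" using arc[of 0] by (simp add: N_def)
    moreover have "x 1 \<noteq> x q" using inj_onD[OF inj, of 1 q] q q2 by auto
    ultimately show ?thesis by auto
  qed
  have N_x: "N (x i) = {x (if i = q then 0 else Suc i), x (if i = 0 then q else i - 1)}" if "i < p" for i
    using that N0 N_Suc[of "i - 1"] xp q q2 by (cases i) auto
  have "x ` {..<p} = pverts G"
  proof (rule closed_under_arcs_eq_pverts[OF conn])
    fix u v assume "u \<in> x ` {..<p}" and uv: "(u, v) \<in> parcs G"
    then obtain i where i: "i < p" "u = x i" by auto
    have "v \<in> N (x i)" using uv i by (simp add: N_def)
    then show "v \<in> x ` {..<p}"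
      using i q unfolding N_x[OF i(1)] by (auto split: if_splits)
  qed (use x_verts q in auto)
  then have bij: "bij_betw x {..<p} (pverts G)"
    using inj by (simp add: bij_betw_def)
  then have card: "card (pverts G) = p"
    using bij_betw_same_card by force
  have arc_iff: "(x i, x j) \<in> parcs G \<longleftrightarrow> j = (i + 1) mod p \<or> i = (j + 1) mod p"
    if "i < p" "j < p" for i j
  proof -
    have eq: "x k = x j \<longleftrightarrow> k = j" if "k < p" for k
      using inj_onD[OF inj, of k j] that \<open>j < p\<close> by auto
    have "(x i, x j) \<in> parcs G \<longleftrightarrow> x j \<in> N (x i)" by (simp add: N_def)
    also have "\<dots> \<longleftrightarrow> j = (if i = q then 0 else Suc i) \<or> j = (if i = 0 then q else i - 1)"
      unfolding N_x[OF that(1)] using that q by (auto simp: eq eq_commute[of "x j"])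
    also have "\<dots> \<longleftrightarrow> j = (i + 1) mod p \<or> i = (j + 1) mod p"
      using that q q2 by (auto simp: mod_Suc)
    finally show ?thesis .
  qed
  \<comment> \<open>The walk maps indices to vertices; the isomorphism from \<open>G\<close> is its
    inverse.\<close>
  have bij': "bij_betw (the_inv_into {..<p} x) (pverts G) {..<p}"
    by (rule bij_betw_the_inv_into[OF bij])
  have wf: "pair_wf_digraph (cycle_graph p)"
    using pair_graph_cycle_graph[of p] q q2 by (simp add: pair_graph_def pair_digraph_def pair_fin_digraph_def)
  have pv: "pverts (cycle_graph p) = {..<p}" by (simp add: cycle_graph_def)
  show ?thesis
    unfolding card
  proof (rule graph_isoI[OF _ wf])
    show "pair_wf_digraph G" by (rule pair_wf_digraph)
    show "bij_betw (the_inv_into {..<p} x) (pverts G) (pverts (cycle_graph p))"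
      using bij' pv by simp
    fix u v assume uv: "u \<in> pverts G" "v \<in> pverts G"
    then obtain i j where ij: "i < p" "j < p" "u = x i" "v = x j"
      using bij unfolding bij_betw_def by (metis imageE lessThan_iff)
    then show "(u, v) \<in> parcs G \<longleftrightarrow>
        (the_inv_into {..<p} x u, the_inv_into {..<p} x v) \<in> parcs (cycle_graph p)"
      using inj by (auto simp: the_inv_into_f_f arc_iff cycle_graph_def)
  qed
qed

section \<open>Counting edges and degrees\<close>

text \<open>Each fibre of (u, v) \<mapsto> {u, v} on the arcs consists of two opposite arcs, which
  differ because there are no loops.\<close>

lemma card_parcs_eq_edges: "card (parcs G) = 2 * card (edges G)"
proof -
  let ?f = "\<lambda>(u, v). {u, v}"
  have "card (parcs G) = (\<Sum>e\<in>?f ` parcs G. card {a \<in> parcs G. ?f a = e})"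
    using sum.image_gen[OF pair_finite_arcs, of "\<lambda>_. 1::nat" ?f] by simp
  also have "\<dots> = (\<Sum>e\<in>?f ` parcs G. 2)"
  proof (rule sum.cong[OF refl])
    fix e assume "e \<in> ?f ` parcs G"
    then obtain u v where uv: "(u, v) \<in> parcs G" "e = {u, v}" by auto
    have "?f a = e \<longleftrightarrow> a = (u, v) \<or> a = (v, u)" for a
      unfolding uv(2) by (cases a) (simp add: doubleton_eq_iff)
    then have "{a \<in> parcs G. ?f a = e} = {(u, v), (v, u)}"
      using uv(1) arcs_symmetric[OF uv(1)] by (simp only:) auto
    then show "card {a \<in> parcs G. ?f a = e} = 2"
      using no_loops'[OF uv(1)] by simp
  qed
  finally show ?thesis by (simp add: edges_def)
qed

lemma sum_degrees: "(\<Sum>u\<in>pverts G. card {v. (u, v) \<in> parcs G}) = card (parcs G)"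
proof -
  have "parcs G = (SIGMA u : pverts G. {v. (u, v) \<in> parcs G})"
    by (auto dest: wellformed')
  moreover have "finite {v. (u, v) \<in> parcs G}" for u
    by (rule finite_subset[OF _ pair_finite_verts]) (auto dest: wellformed')
  then have "card (SIGMA u : pverts G. {v. (u, v) \<in> parcs G}) = (\<Sum>u\<in>pverts G. card {v. (u, v) \<in> parcs G})"
    using pair_finite_verts by (intro card_SigmaI) auto
  ultimately show ?thesis by argo
qed

end

subsection \<open>Bounds for the resolvent function\<close>

text \<open>Truncating after an odd power leaves a nonnegative remainder involving x^8. The sixth
  power is removed by x^6 \<ge> 2 c x^4 - c^2 x^2 with c = 3; for $M_2 = 2n$ and $M_4 = 6n + 4$ the
  best choice is $c = M_4 / M_2 = 3 + 2/n$.\<close>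

lemma resolvent_ge_taylor:
  fixes r x :: real
  assumes "\<bar>x\<bar> < r"
  shows "1 / (r - x) \<ge> 1 / r * x ^ 0 + 1 / r ^ 2 * x ^ 1 + (1 / r ^ 3 - 9 / r ^ 7) * x ^ 2
    + 1 / r ^ 4 * x ^ 3 + (1 / r ^ 5 + 6 / r ^ 7) * x ^ 4 + 1 / r ^ 6 * x ^ 5 + 1 / r ^ 8 * x ^ 7"
proof -
  have r: "r > 0" "r - x > 0" using assms by auto
  \<comment> \<open>The truncated geometric series, multiplied by r^8.\<close>
  let ?S = "\<Sum>k<8. r ^ (7 - k) * x ^ k"
  have "(r - x) * ?S = r ^ 8 - x ^ 8"
    by (simp add: numeral_eq_Suc algebra_simps)
  also have "\<dots> \<le> r ^ 8" by simp
  finally have "?S / r ^ 8 \<le> 1 / (r - x)"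
    using r by (simp add: field_simps)
  moreover have "?S / r ^ 8 = 1 / r + x / r ^ 2 + x ^ 2 / r ^ 3 + x ^ 3 / r ^ 4
      + x ^ 4 / r ^ 5 + x ^ 5 / r ^ 6 + x ^ 6 / r ^ 7 + x ^ 7 / r ^ 8"
    using r by (simp add: numeral_eq_Suc field_simps)
  moreover have "(6 * x ^ 4 - 9 * x ^ 2) / r ^ 7 \<le> x ^ 6 / r ^ 7"
  proof -
    have "x ^ 6 - (6 * x ^ 4 - 9 * x ^ 2) = (x * (x ^ 2 - 3)) ^ 2" by (simp add: numeral_eq_Suc algebra_simps)
    then have "6 * x ^ 4 - 9 * x ^ 2 \<le> x ^ 6"
      by (metis diff_ge_0_iff_ge zero_le_power2)
    then show ?thesis using r by (intro divide_right_mono) auto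
  qed
  ultimately show ?thesis
    by (simp add: algebra_simps diff_divide_distrib)
qed

text \<open>With w = W(r), the right-hand side is the Hermite interpolant of 1 / (r - x) at the
  eigenvalues of $C_5$: once at 2, twice at each root of x^2 + x - 1. Its error has the sign of
  W(x).\<close>

lemma resolvent_le_interpolation:
  fixes r x :: real
  assumes "x \<le> 2" "2 < r"
  defines "w \<equiv> r ^ 5 - 5 * r ^ 3 + 5 * r - 2"
  shows "1 / (r - x) \<le> (r ^ 4 - 5 * r ^ 2 + 5) / w * x ^ 0 + (r ^ 3 - 5 * r) / w * x ^ 1
    + (r ^ 2 - 5) / w * x ^ 2 + r / w * x ^ 3 + 1 / w * x ^ 4"
    and "w > 0"
proof -
  have w: "w = (r - 2) * (r ^ 2 + r - 1) ^ 2" unfolding w_def by (simp add: numeral_eq_Suc algebra_simps)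
  have "r ^ 2 + r - 1 > 0"
    using assms by (smt (verit) zero_le_power2)
  then show "w > 0" using assms(2) unfolding w by simp
  have "x ^ 5 - 5 * x ^ 3 + 5 * x - 2 = - ((2 - x) * (x ^ 2 + x - 1) ^ 2)" by (simp add: numeral_eq_Suc algebra_simps)
  also have "\<dots> \<le> 0" using assms(1) by simp
  finally have "w \<le> w - (x ^ 5 - 5 * x ^ 3 + 5 * x - 2)" by simp
  \<comment> \<open>The difference W(r) - W(x) is divisible by r - x, with quotient
    \<open>?q\<close>.\<close>
  also have "\<dots> = (r - x) * ((r ^ 4 - 5 * r ^ 2 + 5) + (r ^ 3 - 5 * r) * x
    + (r ^ 2 - 5) * x ^ 2 + r * x ^ 3 + 1 * x ^ 4)" (is "_ = _ * ?q")
    unfolding w_def by (simp add: numeral_eq_Suc algebra_simps)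
  finally have "1 / (r - x) \<le> ?q / w"
    using assms(1,2) \<open>w > 0\<close> by (simp add: pos_divide_le_eq pos_le_divide_eq mult.commute)
  then show "1 / (r - x) \<le> (r ^ 4 - 5 * r ^ 2 + 5) / w * x ^ 0 + (r ^ 3 - 5 * r) / w * x ^ 1
    + (r ^ 2 - 5) / w * x ^ 2 + r / w * x ^ 3 + 1 / w * x ^ 4"
    by (simp add: add_divide_distrib)
qed

text \<open>The left-hand side bounds $ER(C_n)$ from above, the right-hand side $ER(G)$ from
  below.\<close>

lemma bound_comparison:
  fixes r :: real
  assumes "r \<ge> 5"
  shows "r * (r ^ 4 - 3 * r ^ 2 + 1) / (r ^ 5 - 5 * r ^ 3 + 5 * r - 2)
    < 1 + 2 * r * (1 / r ^ 3 - 9 / r ^ 7) + (6 * r + 4) * (1 / r ^ 5 + 6 / r ^ 7)"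
proof -
  \<comment> \<open>Expanded around r = 5, the decisive polynomial has only positive
    coefficients.\<close>
  define m where "m = r - 5"
  have m: "m \<ge> 0" "r = m + 5" using assms by (auto simp: m_def)
  have pos: "r ^ 2 + r - 1 > 0" "r ^ 3 - r ^ 2 - 3 * r + 2 > 0"
  proof -
    show "r ^ 2 + r - 1 > 0" using assms by (smt (verit) zero_le_power2)
    have "r ^ 3 - r ^ 2 - 3 * r + 2 = (r - 2) * (r ^ 2 + r - 1)" by (simp add: numeral_eq_Suc algebra_simps)
    also have "\<dots> > 0" using assms \<open>r ^ 2 + r - 1 > 0\<close> by simp
    finally show "r ^ 3 - r ^ 2 - 3 * r + 2 > 0" .
  qed
  \<comment> \<open>Cancelling the common factor r^2 + r - 1 lowers the degree of the final
    inequality.\<close>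
  have e1: "r * (r ^ 4 - 3 * r ^ 2 + 1) = (r * (r ^ 2 - r - 1)) * (r ^ 2 + r - 1)"
    and e2: "r ^ 5 - 5 * r ^ 3 + 5 * r - 2 = (r ^ 3 - r ^ 2 - 3 * r + 2) * (r ^ 2 + r - 1)"
    by (simp_all add: numeral_eq_Suc algebra_simps)
  have e3: "1 + 2 * r * (1 / r ^ 3 - 9 / r ^ 7) + (6 * r + 4) * (1 / r ^ 5 + 6 / r ^ 7)
      = (r ^ 7 + 2 * r ^ 5 + 6 * r ^ 3 + 4 * r ^ 2 + 18 * r + 24) / r ^ 7"
    using assms by (simp add: numeral_eq_Suc field_simps)
  have "0 < (r ^ 7 + 2 * r ^ 5 + 6 * r ^ 3 + 4 * r ^ 2 + 18 * r + 24) * (r ^ 3 - r ^ 2 - 3 * r + 2)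
      - r * (r ^ 2 - r - 1) * r ^ 7" (is "0 < ?P")
  proof -
    have "?P = 2 * m ^ 5 + 46 * m ^ 4 + 426 * m ^ 3 + 1920 * m ^ 2 + 3964 * m ^ 1 + 2618 * m ^ 0"
      unfolding m(2) by (simp add: numeral_eq_Suc algebra_simps)
    also have "\<dots> > 0" using m(1) by (intro add_nonneg_pos) auto
    finally show ?thesis .
  qed
  moreover have "a * c / (b * c) < l / d" if "0 < l * b - a * d" "0 < b" "0 < c" "0 < d"
    for a b c d l :: real
    using that by (simp add: pos_divide_less_eq pos_less_divide_eq)
  ultimately show ?thesis
    unfolding e1 e2 e3 using pos assms by simp
qed

section \<open>Degree squares and closed walks\<close>

text \<open>The deviations e = d - 2 sum to 0, so their squares sum to the same value as e (e - 1),
  which is even. Being positive, that value is at least 2.\<close>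

lemma sum_sq_ge_of_mean_2:
  fixes d :: "'a \<Rightarrow> nat"
  assumes S: "finite S" and mean: "sum d S = 2 * card S" and ne: "\<exists>u\<in>S. d u \<noteq> 2"
  shows "(\<Sum>u\<in>S. (real (d u))\<^sup>2) \<ge> 4 * card S + 2"
proof -
  define e where "e u = int (d u) - 2" for u
  have e0: "(\<Sum>u\<in>S. e u) = 0"
    using mean by (simp add: e_def sum_subtractf flip: of_nat_sum)
  have "(\<Sum>u\<in>S. (e u)\<^sup>2) = (\<Sum>u\<in>S. e u * (e u - 1))"
    using e0 by (simp add: power2_eq_square algebra_simps sum_subtractf)
  also have "even \<dots>" by (intro dvd_sum) simp
  finally have "even (\<Sum>u\<in>S. (e u)\<^sup>2)" .
  moreover have "(\<Sum>u\<in>S. (e u)\<^sup>2) > 0"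
    using ne S by (auto simp: e_def intro!: sum_pos2)
  ultimately have "(\<Sum>u\<in>S. (e u)\<^sup>2) \<ge> 2" by presburger
  also have "(\<Sum>u\<in>S. (e u)\<^sup>2) = (\<Sum>u\<in>S. (int (d u))\<^sup>2 - 4 * e u - 4)"
    by (intro sum.cong) (auto simp: e_def power2_eq_square algebra_simps)
  also have "\<dots> = (\<Sum>u\<in>S. (int (d u))\<^sup>2) - 4 * int (card S)"
    by (simp add: sum_subtractf e0 flip: sum_distrib_left)
  finally have "int (4 * card S + 2) \<le> int (\<Sum>u\<in>S. (d u)\<^sup>2)" by simp
  then have "real (4 * card S + 2) \<le> real (\<Sum>u\<in>S. (d u)\<^sup>2)"
    by (simp only: of_nat_le_iff)
  then show ?thesis by simp
qed

text \<open>For an adjacency matrix \<open>a\<close>, \<open>b i j\<close> counts walks of length 2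
  and \<open>d\<close> gives the degrees. As \<open>b i j\<close> is a natural number, its square is
  at least itself; the diagonal alone contributes d^2 - d to the excess, and all
  \<open>b i j\<close> together sum to the d^2.\<close>

lemma
  fixes a :: "nat \<Rightarrow> nat \<Rightarrow> real"
  assumes a01: "\<And>i j. i < n \<Longrightarrow> j < n \<Longrightarrow> a i j \<in> {0, 1}"
    and sym: "\<And>i j. i < n \<Longrightarrow> j < n \<Longrightarrow> a i j = a j i"
  defines "b \<equiv> \<lambda>i j. \<Sum>l<n. a i l * a l j" and "d \<equiv> \<lambda>i. \<Sum>j<n. a i j"
  shows closed_2_walks_eq_degree: "i < n \<Longrightarrow> b i i = d i"
    and closed_4_walks_ge: "(\<Sum>i<n. \<Sum>j<n. (b i j)\<^sup>2) \<ge> 2 * (\<Sum>i<n. (d i)\<^sup>2) - (\<Sum>i<n. d i)"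
proof -
  have bd: "b i i = d i" if "i < n" for i
    unfolding b_def d_def
  proof (rule sum.cong[OF refl])
    fix l assume "l \<in> {..<n}"
    then show "a i l * a l i = a i l"
      using a01[of i l] sym[of l i] that by auto
  qed
  then show "i < n \<Longrightarrow> b i i = d i" .
  have b_nat: "b i j \<in> \<nat>" if "i < n" "j < n" for i j
  proof -
    have "a i l * a l j = of_bool (a i l = 1 \<and> a l j = 1)" if "l < n" for l
      using a01[of i l] a01[of l j] that \<open>i < n\<close> \<open>j < n\<close> by auto
    then have "b i j = of_nat (\<Sum>l<n. of_bool (a i l = 1 \<and> a l j = 1))"
      by (simp add: b_def del: sum_of_bool_eq)
    then show ?thesis by (metis of_nat_in_Nats)
  qed
  have b_sq: "(b i j)\<^sup>2 - b i j \<ge> 0" if ij: "i < n" "j < n" for i j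
  proof -
    obtain m where "b i j = real m" using b_nat[OF ij] by (auto elim: Nats_cases)
    moreover have "m \<le> m\<^sup>2" by (simp add: power2_nat_le_imp_le power2_eq_square)
    ultimately show ?thesis by (simp flip: of_nat_power)
  qed
  \<comment> \<open>Walks of length 2 are sorted by their middle vertex \<open>l\<close>.\<close>
  have "(\<Sum>i<n. \<Sum>j<n. b i j) = (\<Sum>i<n. \<Sum>l<n. \<Sum>j<n. a i l * a l j)"
    unfolding b_def by (intro sum.cong refl sum.swap)
  also have "\<dots> = (\<Sum>l<n. \<Sum>i<n. a i l * d l)"
    unfolding d_def sum_distrib_left by (rule sum.swap)
  also have "\<dots> = (\<Sum>l<n. (d l)\<^sup>2)"
  proof (rule sum.cong[OF refl])
    fix l assume "l \<in> {..<n}"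
    then have "(\<Sum>i<n. a i l) = d l"
      unfolding d_def by (intro sum.cong) (auto simp: sym)
    then show "(\<Sum>i<n. a i l * d l) = (d l)\<^sup>2"
      by (simp add: power2_eq_square flip: sum_distrib_right)
  qed
  finally have sum_b: "(\<Sum>i<n. \<Sum>j<n. b i j) = (\<Sum>l<n. (d l)\<^sup>2)" .
  have "(\<Sum>i<n. (d i)\<^sup>2 - d i) \<le> (\<Sum>i<n. \<Sum>j<n. (b i j)\<^sup>2 - b i j)"
  proof (rule sum_mono)
    fix i assume "i \<in> {..<n}"
    then show "(d i)\<^sup>2 - d i \<le> (\<Sum>j<n. (b i j)\<^sup>2 - b i j)"
      using member_le_sum[of i "{..<n}" "\<lambda>j. (b i j)\<^sup>2 - b i j"] b_sq bd by auto
  qed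
  then show "(\<Sum>i<n. \<Sum>j<n. (b i j)\<^sup>2) \<ge> 2 * (\<Sum>i<n. (d i)\<^sup>2) - (\<Sum>i<n. d i)"
    by (simp add: sum_subtractf sum_b)
qed

subsection \<open>Resolvent energy\<close>

lemma
  assumes "pair_graph G"
  shows adj_mat_carrier: "adj_mat G vs \<in> carrier_mat (length vs) (length vs)"
    and transpose_adj_mat: "transpose_mat (adj_mat G vs) = adj_mat G vs"
    and adj_mat_01: "\<And>i j. i < length vs \<Longrightarrow> j < length vs \<Longrightarrow> adj_mat G vs $$ (i, j) \<in> {0, 1}"
proof -
  interpret pair_graph G by fact
  show "adj_mat G vs \<in> carrier_mat (length vs) (length vs)"
    and "\<And>i j. i < length vs \<Longrightarrow> j < length vs \<Longrightarrow> adj_mat G vs $$ (i, j) \<in> {0, 1}"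
    by (auto simp: adj_mat_def)
  show "transpose_mat (adj_mat G vs) = adj_mat G vs"
    using arcs_symmetric by (intro eq_matI) (auto simp: adj_mat_def)
qed

lemma sum_adj_mat_row:
  assumes "pair_graph G" "distinct vs" "set vs = pverts G" "i < length vs"
  shows "(\<Sum>j<length vs. adj_mat G vs $$ (i, j)) = card {v. (vs ! i, v) \<in> parcs G}"
proof -
  interpret pair_graph G by fact
  have "(\<Sum>j<length vs. adj_mat G vs $$ (i, j)) =
      (\<Sum>j<length vs. if (vs ! i, vs ! j) \<in> parcs G then 1 else 0)"
    using assms(4) by (intro sum.cong) (auto simp: adj_mat_def)
  also have "\<dots> = (\<Sum>v\<in>set vs. if (vs ! i, v) \<in> parcs G then 1 else 0)"
    by (rule sum.reindex_bij_betw[OF bij_betw_nth]) (use assms in auto)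
  also have "\<dots> = card (set vs \<inter> {v. (vs ! i, v) \<in> parcs G})"
    by (simp add: sum.If_cases)
  also have "set vs \<inter> {v. (vs ! i, v) \<in> parcs G} = {v. (vs ! i, v) \<in> parcs G}"
    using assms(3) by (auto dest: wellformed')
  finally show ?thesis .
qed

text \<open>The bound is \<open>resolvent_ge_taylor\<close> summed over the spectrum, with $M_0 =
  r$, $M_2 = 2r$, $M_4 \<ge> 6r + 4$ and the odd moments dropped.\<close>

lemma resolvent_energy_unicyclic_ge:
  assumes "unicyclic G" and n: "card (pverts G) = n" "n \<ge> 5"
    and not_cycle: "\<not> graph_iso G (cycle_graph n)"
  defines "r \<equiv> real n"
  shows "resolvent_energy G \<ge>
    1 + 2 * r * (1 / r ^ 3 - 9 / r ^ 7) + (6 * r + 4) * (1 / r ^ 5 + 6 / r ^ 7)"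
proof -
  interpret pair_graph G using assms(1) by (simp add: unicyclic_def)
  note pg = pair_graph
  obtain vs where vs: "set vs = pverts G" "distinct vs"
    using finite_distinct_list[OF pair_finite_verts] by blast
  have len: "length vs = n" using vs n by (metis distinct_card)
  let ?deg = "\<lambda>u. card {v. (u, v) \<in> parcs G}"
  define A where "A = adj_mat G vs"
  have A: "A \<in> carrier_mat n n"
    and tr: "transpose_mat A = A"
    and A01: "\<And>i j. i < n \<Longrightarrow> j < n \<Longrightarrow> A $$ (i, j) \<in> {0, 1}"
    using adj_mat_carrier[OF pg, of vs] transpose_adj_mat[OF pg, of vs] adj_mat_01[OF pg, of _ vs]
    unfolding A_def len by auto
  have sym: "A $$ (i, j) = A $$ (j, i)" if "i < n" "j < n" for i j
    using A that by (subst tr[symmetric]) simp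
  define d where "d i = (\<Sum>j<n. A $$ (i, j))" for i
  have d: "d i = ?deg (vs ! i)" if "i < n" for i
    using sum_adj_mat_row[OF pg vs(2,1)] that unfolding d_def A_def len by simp
  have reindex: "(\<Sum>i<n. f (vs ! i)) = (\<Sum>u\<in>pverts G. f u)" for f :: "'a \<Rightarrow> real"
    by (rule sum.reindex_bij_betw[OF bij_betw_nth]) (use vs len in auto)
  have sum_deg: "sum ?deg (pverts G) = 2 * n"
    using sum_degrees card_parcs_eq_edges assms(1) n by (simp add: unicyclic_def)
  have sum_d: "(\<Sum>i<n. d i) = 2 * r"
  proof -
    have "(\<Sum>i<n. d i) = (\<Sum>u\<in>pverts G. real (?deg u))"
      using reindex[of "\<lambda>u. real (?deg u)"] d by simp
    then show ?thesis using sum_deg by (simp add: r_def flip: of_nat_sum)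
  qed
  \<comment> \<open>This is where \<open>not_cycle\<close> enters: it yields the surplus 2 in the
    sum of squared degrees.\<close>
  have "\<exists>u\<in>pverts G. ?deg u \<noteq> 2"
    using connected_2_regular_iso_cycle not_cycle assms(1) n by (auto simp: unicyclic_def)
  then have "4 * r + 2 \<le> (\<Sum>u\<in>pverts G. (real (?deg u))\<^sup>2)"
    using sum_sq_ge_of_mean_2[OF pair_finite_verts, of ?deg] sum_deg n by (simp add: r_def)
  also have "\<dots> = (\<Sum>i<n. (d i)\<^sup>2)"
    using reindex[of "\<lambda>u. (real (?deg u))\<^sup>2"] d by simp
  finally have sum_d2: "(\<Sum>i<n. (d i)\<^sup>2) \<ge> 4 * r + 2" .
  define E where "E = adj_eigenvalues G"
  have E: "E = proots (char_poly A)"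
    unfolding E_def A_def by (rule adj_eigenvalues_eq[OF vs(2,1)])
  define M where "M k = (\<Sum>x\<in>#E. x ^ k)" for k :: nat
  have M: "M k = mat_trace (A ^\<^sub>m k)" for k
    unfolding M_def E by (rule power_sum_eigenvalues_real_symmetric[OF A tr])
  have M_nonneg: "M k \<ge> 0" for k
    unfolding M using A01 by (intro mat_trace_pow_nonneg[OF A]) force
  have M0: "M 0 = r" unfolding M r_def by (rule mat_trace_pow_low(1)[OF A tr])
  have M2: "M 2 = 2 * r"
    unfolding M mat_trace_pow_low(3)[OF A tr] sum_d[symmetric] d_def
    by (intro sum.cong refl closed_2_walks_eq_degree[of n "\<lambda>i j. A $$ (i, j)"])
       (use A01 sym in auto)
  have "2 * (\<Sum>i<n. (d i)\<^sup>2) - (\<Sum>i<n. d i) \<le> M 4"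
    unfolding M mat_trace_pow_low(5)[OF A tr] d_def
    by (intro closed_4_walks_ge[of n "\<lambda>i j. A $$ (i, j)"]) (use A01 sym in auto)
  then have M4: "M 4 \<ge> 6 * r + 4" using sum_d sum_d2 by simp
  have E_lt: "\<bar>x\<bar> < r" if "x \<in># E" for x
  proof -
    have "\<bar>x\<bar> \<le> r - 1"
    proof (rule abs_eigenvalue_le_row_sum[OF A])
      fix i assume i: "i < n"
      have "(\<Sum>j<n. \<bar>A $$ (i, j)\<bar>) = d i"
        unfolding d_def using A01 i by (intro sum.cong) force+
      also have "\<dots> = ?deg (vs ! i)" by (rule d[OF i])
      also have "?deg (vs ! i) \<le> card (pverts G - {vs ! i})"
        using pair_finite_verts by (intro card_mono) (auto dest: wellformed' no_loops')
      also have "\<dots> = n - 1"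
        using nth_mem[of i vs] i vs(1) len n(1) by (simp add: card_Diff_singleton)
      finally show "(\<Sum>j<n. \<bar>A $$ (i, j)\<bar>) \<le> r - 1" using n by (simp add: r_def of_nat_diff)
    qed (use that E in simp)
    then show ?thesis by simp
  qed
  have r: "r \<ge> 5" using n by (simp add: r_def)
  \<comment> \<open>The coefficient of $M_4$ must be nonnegative, as $M_4$ is only bounded below;
    $M_2$ is known exactly.\<close>
  have c4: "0 \<le> 1 / r ^ 5 + 6 / r ^ 7" using r by simp
  have "1 + (1 / r ^ 3 - 9 / r ^ 7) * (2 * r) + (1 / r ^ 5 + 6 / r ^ 7) * (6 * r + 4)
      \<le> 1 / r * M 0 + 1 / r ^ 2 * M 1 + (1 / r ^ 3 - 9 / r ^ 7) * M 2 + 1 / r ^ 4 * M 3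
        + (1 / r ^ 5 + 6 / r ^ 7) * M 4 + 1 / r ^ 6 * M 5 + 1 / r ^ 8 * M 7"
  proof -
    have "1 / r * M 0 = 1" using M0 r by simp
    moreover have "0 \<le> 1 / r ^ 2 * M 1" "0 \<le> 1 / r ^ 4 * M 3" "0 \<le> 1 / r ^ 6 * M 5" "0 \<le> 1 / r ^ 8 * M 7"
      using M_nonneg r by simp_all
    moreover have "(1 / r ^ 5 + 6 / r ^ 7) * (6 * r + 4) \<le> (1 / r ^ 5 + 6 / r ^ 7) * M 4"
      using M4 c4 by (rule mult_left_mono)
    ultimately show ?thesis unfolding M2 by linarith
  qed
  also have "\<dots> = (\<Sum>x\<in>#E. 1 / r * x ^ 0 + 1 / r ^ 2 * x ^ 1 + (1 / r ^ 3 - 9 / r ^ 7) * x ^ 2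
    + 1 / r ^ 4 * x ^ 3 + (1 / r ^ 5 + 6 / r ^ 7) * x ^ 4 + 1 / r ^ 6 * x ^ 5 + 1 / r ^ 8 * x ^ 7)"
    unfolding M_def sum_mset.distrib sum_mset_distrib_left ..
  also have "\<dots> \<le> (\<Sum>x\<in>#E. 1 / (r - x))"
    by (intro sum_mset_mono resolvent_ge_taylor E_lt)
  also have "\<dots> = resolvent_energy G"
    by (simp add: resolvent_energy_def E_def r_def n)
  finally show ?thesis by (simp add: mult.commute)
qed

text \<open>The bound is \<open>resolvent_le_interpolation\<close> summed over the spectrum, with
  the moments $M_0, \<dots>, M_4$ equal to r, 0, 2r, 0, 6r.\<close>

lemma resolvent_energy_cycle_graph_le:
  assumes n: "n \<ge> 5"
  defines "r \<equiv> real n"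
  shows "resolvent_energy (cycle_graph n) \<le>
    r * (r ^ 4 - 3 * r ^ 2 + 1) / (r ^ 5 - 5 * r ^ 3 + 5 * r - 2)"
proof -
  have pg: "pair_graph (cycle_graph n)" using n by (intro pair_graph_cycle_graph) simp
  define A where "A = adj_mat (cycle_graph n) [0..<n]"
  have A: "A \<in> carrier_mat n n"
    and tr: "transpose_mat A = A"
    using adj_mat_carrier[OF pg, of "[0..<n]"] transpose_adj_mat[OF pg, of "[0..<n]"]
    unfolding A_def by auto
  \<comment> \<open>Successor and predecessor on the cycle, written without \<open>mod\<close> so
    that case splits and linear arithmetic apply.\<close>
  define s where "s i = (if Suc i = n then 0 else Suc i)" for i
  define t where "t i = (if i = 0 then n - 1 else i - 1)" for i
  \<comment> \<open>For n \<ge> 5 the vertices at offsets -2, -1, 0, 1, 2 from \<open>i\<close> are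
    distinct, which excludes triangles and 4-cycles.\<close>
  have st: "s i < n" "t i < n" "t (s i) = i" "s (t i) = i" "s i \<noteq> i" "t i \<noteq> i" "s i \<noteq> t i"
    "s (s i) \<noteq> i" "t (t i) \<noteq> i" "s (s i) \<noteq> t (t i)"
    "s (s i) \<noteq> s i" "s (s i) \<noteq> t i" "t (t i) \<noteq> s i" "t (t i) \<noteq> t i"
    if "i < n" for i
    using that n unfolding s_def t_def by (auto split: if_splits)
  have a: "A $$ (i, j) = (if j = s i then 1 else 0) + (if j = t i then 1 else 0)"
    if "i < n" "j < n" for i j
  proof -
    have "j = (i + 1) mod n \<or> i = (j + 1) mod n \<longleftrightarrow> j = s i \<or> j = t i"
      using that n by (auto simp: s_def t_def mod_Suc)
    then show ?thesis
      using that st(7)[OF that(1)] by (auto simp: A_def adj_mat_def cycle_graph_def)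
  qed
  have row: "(\<Sum>j<n. A $$ (i, j) * f j) = f (s i) + f (t i)" if "i < n" for i f
  proof -
    have "(\<Sum>j<n. A $$ (i, j) * f j) =
        (\<Sum>j<n. (if j = s i then f j else 0) + (if j = t i then f j else 0))"
      by (intro sum.cong) (auto simp: a that distrib_right)
    then show ?thesis using st[OF that] by (simp add: sum.distrib)
  qed
  define b where "b i j = (\<Sum>l<n. A $$ (i, l) * A $$ (l, j))" for i j
  \<comment> \<open>Two steps forward, two steps back, or a return to \<open>i\<close> through
    either neighbour.\<close>
  have b: "b i j = (if j = s (s i) then 1 else 0) + (if j = i then 2 else 0) + (if j = t (t i) then 1 else 0)"
    if "i < n" "j < n" for i j
    unfolding b_def row[OF that(1)] using that st[OF that(1)] by (simp add: a)
  define E where "E = adj_eigenvalues (cycle_graph n)"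
  have E: "E = proots (char_poly A)"
    unfolding E_def A_def by (rule adj_eigenvalues_eq) (auto simp: cycle_graph_def)
  define M where "M k = (\<Sum>x\<in>#E. x ^ k)" for k :: nat
  have M: "M k = mat_trace (A ^\<^sub>m k)" for k
    unfolding M_def E by (rule power_sum_eigenvalues_real_symmetric[OF A tr])
  have M0: "M 0 = r" unfolding M r_def by (rule mat_trace_pow_low(1)[OF A tr])
  have M1: "M 1 = 0"
    unfolding M mat_trace_pow_low(2)[OF A tr]
    by (rule sum.neutral) (simp add: a st(5,6)[symmetric])
  have M2: "M 2 = 2 * r"
  proof -
    have "M 2 = (\<Sum>i<n. b i i)"
      unfolding M mat_trace_pow_low(3)[OF A tr] b_def ..
    also have "\<dots> = (\<Sum>i<n. 2)"
    proof (rule sum.cong[OF refl])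
      fix i assume "i \<in> {..<n}"
      then show "b i i = 2" using st(8,9)[of i, symmetric] by (simp add: b)
    qed
    finally show ?thesis by (simp add: r_def)
  qed
  have M3: "M 3 = 0"
  proof -
    have "M 3 = (\<Sum>i<n. \<Sum>j<n. b i j * A $$ (i, j))"
      unfolding M mat_trace_pow_low(4)[OF A tr] b_def ..
    also have "\<dots> = 0"
    proof (intro sum.neutral ballI)
      \<comment> \<open>Two steps end at offset 0 or \<plusminus>2, never at a neighbour of
        \<open>i\<close>.\<close>
      fix i j assume "i \<in> {..<n}" "j \<in> {..<n}"
      then show "b i j * A $$ (i, j) = 0" using st[of i] by (auto simp: b a)
    qed
    finally show ?thesis .
  qed
  have M4: "M 4 = 6 * r"
  proof -
    have "M 4 = (\<Sum>i<n. \<Sum>j<n. (b i j)\<^sup>2)"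
      unfolding M mat_trace_pow_low(5)[OF A tr] b_def ..
    also have "\<dots> = (\<Sum>i<n. 6)"
    proof (rule sum.cong[OF refl])
      fix i assume i: "i \<in> {..<n}"
      \<comment> \<open>The nonzero entries 1, 2, 1 of the row sit at distinct positions, so
        squaring acts on each separately.\<close>
      then have "(\<Sum>j<n. (b i j)\<^sup>2) = (\<Sum>j<n. (if j = s (s i) then 1 else 0) + (if j = i then 4 else 0)
          + (if j = t (t i) then 1 else 0))"
        using st[of i] by (intro sum.cong) (auto simp: b)
      also have "\<dots> = 6" using i st by (simp add: sum.distrib)
      finally show "(\<Sum>j<n. (b i j)\<^sup>2) = 6" .
    qed
    finally show ?thesis by (simp add: r_def)
  qed
  have E_le: "x \<le> 2" if "x \<in># E" for x
  proof -
    have "\<bar>x\<bar> \<le> 2"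
    proof (rule abs_eigenvalue_le_row_sum[OF A])
      fix i assume i: "i < n"
      have "(\<Sum>j<n. \<bar>A $$ (i, j)\<bar>) = (\<Sum>j<n. A $$ (i, j) * 1)"
        using i by (intro sum.cong) (auto simp: a)
      then show "(\<Sum>j<n. \<bar>A $$ (i, j)\<bar>) \<le> 2" using row[OF i, of "\<lambda>_. 1"] by simp
    qed (use that E in simp)
    then show ?thesis by simp
  qed
  have r: "2 < r" using n by (simp add: r_def)
  define w where "w = r ^ 5 - 5 * r ^ 3 + 5 * r - 2"
  have "resolvent_energy (cycle_graph n) = (\<Sum>x\<in>#E. 1 / (r - x))"
    by (simp add: resolvent_energy_def E_def r_def cycle_graph_def)
  also have "\<dots> \<le> (\<Sum>x\<in>#E. (r ^ 4 - 5 * r ^ 2 + 5) / w * x ^ 0 + (r ^ 3 - 5 * r) / w * x ^ 1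
    + (r ^ 2 - 5) / w * x ^ 2 + r / w * x ^ 3 + 1 / w * x ^ 4)"
    unfolding w_def by (intro sum_mset_mono resolvent_le_interpolation E_le r)
  also have "\<dots> = (r ^ 4 - 5 * r ^ 2 + 5) / w * M 0 + (r ^ 3 - 5 * r) / w * M 1
    + (r ^ 2 - 5) / w * M 2 + r / w * M 3 + 1 / w * M 4"
    unfolding M_def sum_mset.distrib sum_mset_distrib_left ..
  also have "\<dots> = ((r ^ 4 - 5 * r ^ 2 + 5) * r + (r ^ 2 - 5) * (2 * r) + 6 * r) / w"
    unfolding M0 M1 M2 M3 M4 by (simp flip: add_divide_distrib)
  also have "(r ^ 4 - 5 * r ^ 2 + 5) * r + (r ^ 2 - 5) * (2 * r) + 6 * r = r * (r ^ 4 - 3 * r ^ 2 + 1)"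
    by (simp add: numeral_eq_Suc algebra_simps)
  finally show ?thesis by (simp add: w_def)
qed

theorem theorem5:
  fixes G :: "'a pair_pre_digraph" and n :: nat
  assumes "n \<ge> 5"
    and "unicyclic G"
    and "card (pverts G) = n"
    and "\<not> graph_iso G (cycle_graph n)"
    and "\<not> graph_iso G (cycle_pendant_graph n)"
  shows "resolvent_energy G >
    min (resolvent_energy (cycle_graph n)) (resolvent_energy (cycle_pendant_graph n))"
proof -
  have "resolvent_energy (cycle_graph n) < resolvent_energy G"
    using resolvent_energy_cycle_graph_le[OF assms(1)] bound_comparison[of "real n"]
      resolvent_energy_unicyclic_ge[OF assms(2,3,1,4)] assms(1)
    by linarith
  then show ?thesis by simp
qed

end
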